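(* Let $\mathcal{Q}$ be a finite nonempty set of positive integers with largest element $q$. Let $p_1<p_2<\cdots<p_a$ be the elements of $\{1,\ldots,q\}\setminus\mathcal{Q}$, and suppose $a\ge2$. Define $r$ by $p_a=q-r$ (so $r\ge1$). Let $\theta$ be the bit string representing $\mathcal{Q}$. Suppose that for each $i=1,\ldots,a-1$ the bit string $\theta\mid\lfloor\theta/2^{p_i}\rfloor$ is all ones after discarding the leading zeros. Suppose further that either (a) $q=2r+1$, or (b) $q>2r+1$ and $1\le p_{a-1}\le r$. Then for each $n\ge0$, the number of subsets of $\{1,\ldots,n\}$ such that no two elements of the subset differ by an element of $\mathcal{Q}$ equals the number of compositions of $n+q$ into parts drawn from the set consisting of $1$, $q+1$, $q+1+p_i$ for $i=1,\ldots,a-1$, and $q+1+j(q-r)$ for all positive integers $j$.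
   Context: The bit string $\theta$ representing $\mathcal{Q}$ is the one whose $j$-th bit from the right is $1$ iff $j\in\mathcal{Q}$, i.e., $\theta=\sum_{j\in\mathcal{Q}}2^{j-1}$. $\lfloor\theta/2^b\rfloor$ means discarding the rightmost $b$ bits of $\theta$ and shifting the remaining bits right by $b$ places. $\mid$ denotes bitwise OR. A composition of a positive integer is an expression of it as an ordered sum of positive integers (the parts); parts may be repeated. *)

theory Defs
  imports Main
begin

unbundle bit_operations_syntax

definition bit_string :: "nat set \<Rightarrow> nat" where
  "bit_string Q = (\<Sum>j\<in>Q. 2 ^ (j - 1))"

text \<open>Below any bit that is \<open>1\<close> every bit is \<open>1\<close>: the binary representation, after discarding
  the leading zeros, consists of ones only.\<close>

definition all_ones :: "nat \<Rightarrow> bool" where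
  "all_ones x \<longleftrightarrow> (\<forall>i j. i \<le> j \<longrightarrow> bit x j \<longrightarrow> bit x i)"

definition difference_avoiding_subsets :: "nat set \<Rightarrow> nat \<Rightarrow> nat set set" where
  "difference_avoiding_subsets Q n =
     {S. S \<subseteq> {1..n} \<and> (\<forall>x\<in>S. \<forall>y\<in>S. x < y \<longrightarrow> y - x \<notin> Q)}"

definition compositions :: "nat set \<Rightarrow> nat \<Rightarrow> nat list set" where
  "compositions P m = {xs. set xs \<subseteq> P \<and> (\<forall>x\<in>set xs. 0 < x) \<and> sum_list xs = m}"

end

theory Submission
  imports Defs
begin

text \<open>Call two elements of an avoiding set linked when they are consecutive and at most \<open>q\<close>
  apart. Since \<open>q\<close> is the largest forbidden difference, elements more than \<open>q\<close> apart do not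
  interact, so an avoiding set is a sequence of independent clusters, the maximal linked runs.
  Reserve for a cluster of span \<open>d\<close> its own \<open>d + 1\<close> cells and \<open>q\<close> empty cells before it, where
  the first cluster may reach up to \<open>q\<close> cells below \<open>1\<close>. The avoiding subsets of \<open>{1..n}\<close>
  thus become the tilings of \<open>n + q\<close> cells by single empty cells and by tiles of length
  \<open>q + 1 + d\<close>, one tile for each possible cluster shape of span \<open>d\<close>. If a cluster is determined
  by its span, these tilings are compositions of \<open>n + q\<close>; this is
  \<open>card_avoiding_eq_card_compositions\<close>.

  It remains to find the clusters for the given \<open>Q\<close>. The gaps inside a cluster are allowed
  differences at most \<open>q\<close>, that is, values of \<open>p\<close>. The condition on bit strings says that
  \<open>p i + p k \<in> Q\<close> for all \<open>i < a\<close> and all \<open>k\<close>, so a gap \<open>p i\<close> with \<open>i < a\<close> cannot have a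
  neighbouring gap. The gap \<open>p a = q - r\<close> can be repeated without restriction, because
  \<open>2 * (q - r) > q\<close> in both cases of the hypothesis. Hence the spans are \<open>0\<close>, \<open>p i\<close> for \<open>i < a\<close>
  and \<open>j * (q - r)\<close> for \<open>j \<ge> 1\<close>, each coming from exactly one cluster; this is
  \<open>clusters_eq\<close>.\<close>

section \<open>Counting compositions\<close>

lemma compositions_0: "compositions P 0 = {[]}"
  by (auto simp: compositions_def) (metis list.set_intros(1) neq_Nil_conv not_less_zero)

lemma compositions_pos:
  assumes "0 < m"
  shows "compositions P m = (\<Union>x\<in>P \<inter> {1..m}. (#) x ` compositions P (m - x))"
proof (intro equalityI subsetI)
  fix xs assume xs: "xs \<in> compositions P m"
  with assms obtain x ys where "xs = x # ys"
    by (cases xs) (auto simp: compositions_def)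
  with xs have "x \<in> P \<inter> {1..m}" and "ys \<in> compositions P (m - x)"
    by (auto simp: compositions_def)
  with \<open>xs = x # ys\<close> show "xs \<in> (\<Union>x\<in>P \<inter> {1..m}. (#) x ` compositions P (m - x))"
    by blast
next
  fix xs assume "xs \<in> (\<Union>x\<in>P \<inter> {1..m}. (#) x ` compositions P (m - x))"
  then show "xs \<in> compositions P m"
    by (auto simp: compositions_def)
qed

lemma finite_compositions: "finite (compositions P m)"
proof (induction m rule: less_induct)
  case (less m)
  show ?case
    by (cases "m = 0") (use less in \<open>auto simp: compositions_0 compositions_pos\<close>)
qed

lemma card_compositions_pos:
  assumes "0 < m"
  shows "card (compositions P m) = (\<Sum>x\<in>P \<inter> {1..m}. card (compositions P (m - x)))"
  unfolding compositions_pos[OF assms]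
  by (subst card_UN_disjoint) (auto simp: finite_compositions card_image)

section \<open>Cluster decomposition of avoiding sets\<close>

definition avoiding :: "nat set \<Rightarrow> nat set \<Rightarrow> bool" where
  "avoiding Q S \<longleftrightarrow> (\<forall>x\<in>S. \<forall>y\<in>S. x < y \<longrightarrow> y - x \<notin> Q)"

lemma avoidingD: "avoiding Q S \<Longrightarrow> x \<in> S \<Longrightarrow> y \<in> S \<Longrightarrow> x < y \<Longrightarrow> y - x \<notin> Q"
  by (auto simp: avoiding_def)

lemma difference_avoiding_subsets_iff:
  "S \<in> difference_avoiding_subsets Q n \<longleftrightarrow> S \<subseteq> {1..n} \<and> avoiding Q S"
  by (auto simp: difference_avoiding_subsets_def avoiding_def)

lemma finite_difference_avoiding_subsets: "finite (difference_avoiding_subsets Q n)"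
  by (rule finite_subset[of _ "Pow {1..n}"]) (auto simp: difference_avoiding_subsets_def)

lemma difference_avoiding_subsets_0: "difference_avoiding_subsets Q 0 = {{}}"
  by (auto simp: difference_avoiding_subsets_def)

text \<open>A cluster is recorded by the distances of its elements from its largest element, so that
  its span is \<open>Max K\<close>.\<close>

definition clusters :: "nat set \<Rightarrow> nat \<Rightarrow> nat set set" where
  "clusters Q q = {K. finite K \<and> 0 \<in> K \<and> avoiding Q K \<and>
     (\<forall>x\<in>K. x < Max K \<longrightarrow> (\<exists>y\<in>K. x < y \<and> y \<le> x + q))}"

text \<open>Cut at the first gap longer than \<open>q\<close> below the largest element: the elements above that gap
  form the last cluster, and the elements below it are unrestricted by that cluster.\<close>

lemma cluster_split:
  assumes "finite E" and "0 \<in> E" and "avoiding Q E"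
  obtains K where "K \<in> clusters Q q" and "K = E \<inter> {..Max K + q}"
proof -
  define d where "d = (LEAST d. d \<in> E \<and> E \<inter> {d<..d + q} = {})"
  have "Max E \<in> E"
    using assms(1,2) by (intro Max_in) auto
  then have "Max E \<in> E \<and> E \<inter> {Max E<..Max E + q} = {}"
    using assms(1) by (auto simp flip: not_le)
  then have "d \<in> E \<and> E \<inter> {d<..d + q} = {}"
    unfolding d_def by (rule LeastI)
  then have d: "d \<in> E" "E \<inter> {d<..d + q} = {}"
    by simp_all
  have step: "\<exists>e\<in>E. x < e \<and> e \<le> x + q" if "x \<in> E" "x < d" for x
    using not_less_Least[of x "\<lambda>d. d \<in> E \<and> E \<inter> {d<..d + q} = {}"] that
    unfolding d_def[symmetric] by auto
  define K where "K = E \<inter> {..d}"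
  have Max: "Max K = d"
    by (rule Max_eqI) (use assms d in \<open>auto simp: K_def\<close>)
  have "\<exists>y\<in>K. x < y \<and> y \<le> x + q" if x: "x \<in> K" "x < d" for x
  proof -
    obtain e where e: "e \<in> E" "x < e" "e \<le> x + q"
      using step x by (auto simp: K_def)
    with d x have "e \<le> d"
      by (metis (no_types, lifting) add_le_mono1 disjoint_iff greaterThanAtMost_iff
          leI le_trans less_imp_le)
    with e show ?thesis by (auto simp: K_def)
  qed
  then have "K \<in> clusters Q q"
    using assms Max by (auto simp: clusters_def K_def avoiding_def)
  moreover have "K = E \<inter> {..Max K + q}"
    using d(2) unfolding Max by (fastforce simp: K_def)
  ultimately show thesis by (rule that)
qed

text \<open>An element followed within distance \<open>q\<close> by another one is not the end of a cluster, so the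
  shorter of two clusters cut from the same set would have to continue.\<close>

lemma cluster_split_unique:
  assumes "K \<in> clusters Q q" and "K = E \<inter> {..Max K + q}"
    and "K' \<in> clusters Q q" and "K' = E \<inter> {..Max K' + q}"
  shows "K = K'"
proof -
  have *: "\<not> Max K < Max K'" if K: "K \<in> clusters Q q" "K = E \<inter> {..Max K + q}"
      and K': "K' \<in> clusters Q q" "K' = E \<inter> {..Max K' + q}" for K K'
  proof
    assume less: "Max K < Max K'"
    have "Max K \<in> K"
      using K by (intro Max_in) (auto simp: clusters_def)
    then have "Max K \<in> E" using K(2) by blast
    then have "Max K \<in> K'" using K'(2) less by (metis IntI atMost_iff less_imp_le trans_le_add1)
    then obtain y where y: "y \<in> K'" "Max K < y" "y \<le> Max K + q"
      using K'(1) less by (auto simp: clusters_def)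
    then have "y \<in> E" using K'(2) by blast
    then have "y \<in> K" using K(2) y by (metis IntI atMost_iff)
    then have "y \<le> Max K" using K(1) by (auto simp: clusters_def)
    with y show False by simp
  qed
  have "Max K = Max K'"
    using *[OF assms] *[OF assms(3,4,1,2)] by simp
  with assms show ?thesis by metis
qed

text \<open>An avoiding set with largest element \<open>n\<close> is the same as a choice of its last cluster
  \<open>K\<close> together with any avoiding set \<open>T\<close> lying more than \<open>q\<close> below that cluster. Injectivity of
  gluing them together is the uniqueness of the cut.\<close>

lemma card_avoiding_last_cluster:
  assumes Q: "Q \<subseteq> {..q}" and n: "0 < n"
  shows "card {S \<in> difference_avoiding_subsets Q n. n \<in> S} =
    (\<Sum>K\<in>{K \<in> clusters Q q. Max K < n}. card (difference_avoiding_subsets Q (n - 1 - Max K - q)))"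
    (is "card ?A = (\<Sum>K\<in>?C. card (?T K))")
proof -
  \<comment> \<open>Truncated subtraction of elements of \<open>K\<close> from \<open>n\<close> is exact, as they are below \<open>n\<close>;
    restricting \<open>offsets\<close> to \<open>e < n\<close> keeps \<open>n - e\<close> exact as well.\<close>
  define glue where "glue = (\<lambda>(K, T). T \<union> (-) n ` K :: nat set)"
  define offsets where "offsets = (\<lambda>S. {e. e < n \<and> n - e \<in> S})"
  have K: "finite K" "0 \<in> K" "avoiding Q K" "\<And>x. x \<in> K \<Longrightarrow> x \<le> Max K \<and> x < n"
    if "K \<in> ?C" for K
    using that by (auto simp: clusters_def intro: le_less_trans[OF Max_ge])
  have T: "0 < s \<and> s + Max K + q < n" if "T \<in> ?T K" "s \<in> T" for K T s
    using that by (fastforce simp: difference_avoiding_subsets_iff)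
  have offsets_glue: "offsets (glue (K, T)) \<inter> {..Max K + q} = K" if "K \<in> ?C" "T \<in> ?T K" for K T
  proof (intro equalityI subsetI)
    fix e assume e: "e \<in> offsets (glue (K, T)) \<inter> {..Max K + q}"
    then have "n - e \<notin> T" using T[OF that(2), of "n - e"] by (auto simp: offsets_def)
    with e obtain k where "k \<in> K" "n - e = n - k" "e < n"
      by (auto simp: offsets_def glue_def)
    with K(4)[OF that(1), of k] show "e \<in> K" by (metis diff_diff_cancel less_imp_le)
  next
    fix e assume "e \<in> K"
    with K(4)[OF that(1), of e] show "e \<in> offsets (glue (K, T)) \<inter> {..Max K + q}"
      by (auto simp: offsets_def glue_def)
  qed
  have glue_low: "{s \<in> glue (K, T). s + Max K + q < n} = T" if "K \<in> ?C" "T \<in> ?T K" for K T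
  proof -
    have "\<not> n - k + Max K + q < n" if "k \<in> K" for k
      using K(4)[OF \<open>K \<in> ?C\<close> that] by auto
    with T[OF that(2)] show ?thesis by (auto simp: glue_def)
  qed
  have "inj_on glue (SIGMA K:?C. ?T K)"
  proof (rule inj_onI, clarify)
    fix K T K' T'
    assume KT: "K \<in> clusters Q q" "Max K < n" "T \<in> ?T K"
      "K' \<in> clusters Q q" "Max K' < n" "T' \<in> ?T K'" and eq: "glue (K, T) = glue (K', T')"
    have "K = K'"
      by (rule cluster_split_unique[where E = "offsets (glue (K, T))"])
        (use KT offsets_glue[of K T] offsets_glue[of K' T'] eq in auto)
    moreover have "T = {s \<in> glue (K, T). s + Max K + q < n}"
      using glue_low[of K T] KT(1-3) by simp
    moreover have "T' = {s \<in> glue (K', T'). s + Max K' + q < n}"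
      using glue_low[of K' T'] KT(4-6) by simp
    ultimately show "K = K' \<and> T = T'"
      using eq by metis
  qed
  moreover have "glue ` (SIGMA K:?C. ?T K) = ?A"
  proof (intro equalityI subsetI)
    fix S assume "S \<in> glue ` (SIGMA K:?C. ?T K)"
    then obtain K T where KT: "K \<in> ?C" "T \<in> ?T K" and S: "S = glue (K, T)" by auto
    have "y - x \<notin> Q" if xy: "x \<in> S" "y \<in> S" "x < y" for x y
    proof -
      consider "x \<in> T" "y \<in> T" | k where "x \<in> T" "k \<in> K" "y = n - k"
        | k where "y \<in> T" "k \<in> K" "x = n - k"
        | k k' where "k \<in> K" "k' \<in> K" "x = n - k" "y = n - k'"
        using xy S by (auto simp: glue_def)
      then show ?thesis
      proof cases
        case 1
        then show ?thesis using KT(2) xy(3)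
          by (auto simp: difference_avoiding_subsets_iff avoiding_def)
      next
        case 2
        then have "q < y - x"
          using K(4)[OF KT(1), of k] T[OF KT(2), of x] by auto
        then show ?thesis using Q by auto
      next
        case 3
        then show ?thesis
          using K(4)[OF KT(1), of k] T[OF KT(2), of y] xy(3) by auto
      next
        case 4
        then have "y - x = k - k'" "k' < k"
          using K(4)[OF KT(1), of k] K(4)[OF KT(1), of k'] xy(3) by auto
        then show ?thesis using avoidingD[OF K(3)[OF KT(1)]] 4 by auto
      qed
    qed
    moreover have "S \<subseteq> {1..n}"
      using T[OF KT(2)] K(4)[OF KT(1)] by (force simp: S glue_def)
    moreover have "n \<in> S"
      using K(2)[OF KT(1)] by (force simp: S glue_def)
    ultimately show "S \<in> ?A" by (auto simp: difference_avoiding_subsets_iff avoiding_def)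
  next
    fix S assume "S \<in> ?A"
    then have S: "S \<subseteq> {1..n}" "avoiding Q S" "n \<in> S"
      by (auto simp: difference_avoiding_subsets_iff)
    have "avoiding Q (offsets S)"
      unfolding avoiding_def
    proof (intro ballI impI)
      fix x y assume "x \<in> offsets S" "y \<in> offsets S" "x < y"
      then have "n - x \<in> S" "n - y \<in> S" "n - y < n - x" "y - x = (n - x) - (n - y)"
        by (auto simp: offsets_def)
      then show "y - x \<notin> Q" using avoidingD[OF S(2)] by metis
    qed
    then obtain K where K1: "K \<in> clusters Q q" and K2: "K = offsets S \<inter> {..Max K + q}"
      using S(3) n by (elim cluster_split[of "offsets S" Q q, rotated -1]) (auto simp: offsets_def)
    have "Max K \<in> K"
      using K1 by (intro Max_in) (auto simp: clusters_def)
    then have KC: "K \<in> ?C" using K1 K2 by (auto simp: offsets_def)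
    define T where "T = {s \<in> S. s + Max K + q < n}"
    have "T \<in> ?T K"
      using S by (auto simp: difference_avoiding_subsets_iff T_def avoiding_def)
    moreover have "S = glue (K, T)"
    proof (intro equalityI subsetI)
      fix s assume s: "s \<in> S"
      show "s \<in> glue (K, T)"
      proof (cases "s \<in> T")
        case False
        have "1 \<le> s" "s \<le> n" using S(1) s by auto
        with False s have "n - s \<in> K"
          by (subst K2) (auto simp: offsets_def T_def)
        then have "n - (n - s) \<in> glue (K, T)" by (simp only: glue_def) blast
        with \<open>s \<le> n\<close> show ?thesis by simp
      qed (simp add: glue_def)
    next
      fix s assume "s \<in> glue (K, T)"
      moreover have "n - k \<in> S" if "k \<in> K" for k
        using that by (subst (asm) K2) (simp add: offsets_def)
      ultimately show "s \<in> S" by (auto simp: glue_def T_def)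
    qed
    ultimately show "S \<in> glue ` (SIGMA K:?C. ?T K)"
      using KC by (intro image_eqI[of _ _ "(K, T)"]) auto
  qed
  ultimately have "bij_betw glue (SIGMA K:?C. ?T K) ?A"
    by (simp add: bij_betw_def)
  then have "card ?A = card (SIGMA K:?C. ?T K)"
    by (rule bij_betw_same_card[symmetric])
  moreover have "?C \<subseteq> Pow {..n}"
    using K(4) by fastforce
  then have "finite ?C"
    by (rule finite_subset) simp
  ultimately show ?thesis
    by (simp add: finite_difference_avoiding_subsets)
qed

lemma card_difference_avoiding_subsets_rec:
  assumes "Q \<subseteq> {..q}" and "0 < n"
  shows "card (difference_avoiding_subsets Q n) = card (difference_avoiding_subsets Q (n - 1)) +
    (\<Sum>K\<in>{K \<in> clusters Q q. Max K < n}. card (difference_avoiding_subsets Q (n - 1 - Max K - q)))"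
proof -
  let ?A = "{S \<in> difference_avoiding_subsets Q n. n \<in> S}"
  have "S \<subseteq> {1..n - 1} \<longleftrightarrow> S \<subseteq> {1..n} \<and> n \<notin> S" for S
    using assms(2) by (auto simp: subset_iff) (metis Suc_pred le_Suc_eq)+
  then have "S \<in> difference_avoiding_subsets Q (n - 1) \<longleftrightarrow>
      S \<in> difference_avoiding_subsets Q n \<and> n \<notin> S" for S
    unfolding difference_avoiding_subsets_iff by blast
  then have "difference_avoiding_subsets Q n = difference_avoiding_subsets Q (n - 1) \<union> ?A"
      and "difference_avoiding_subsets Q (n - 1) \<inter> ?A = {}"
    by blast+
  then have "card (difference_avoiding_subsets Q n) =
      card (difference_avoiding_subsets Q (n - 1)) + card ?A"
    by (metis (no_types, lifting) card_Un_disjoint finite_Un finite_difference_avoiding_subsets)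
  then show ?thesis
    using card_avoiding_last_cluster[OF assms] by simp
qed

text \<open>Both sides satisfy the same recurrence in the length \<open>m = n + q\<close>. Truncated subtraction
  makes this uniform: if fewer than \<open>q\<close> cells remain below a cluster, the index
  \<open>n - 1 - Max K - q\<close> is \<open>0\<close> and the empty set is counted, and correspondingly all
  compositions of \<open>m \<le> q\<close> consist of ones.\<close>

theorem card_avoiding_eq_card_compositions:
  assumes Q: "Q \<subseteq> {..q}" and q: "0 < q" and inj: "inj_on Max (clusters Q q)"
  shows "card (difference_avoiding_subsets Q n) =
    card (compositions ({1} \<union> (\<lambda>K. q + 1 + Max K) ` clusters Q q) (n + q))"
proof -
  let ?P = "{1} \<union> (\<lambda>K. q + 1 + Max K) ` clusters Q q"
  have "card (compositions ?P m) = card (difference_avoiding_subsets Q (m - q))" for m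
  proof (induction m rule: less_induct)
    case (less m)
    show ?case
    proof (cases "m = 0")
      case True
      then show ?thesis
        by (simp add: compositions_0 difference_avoiding_subsets_0)
    next
      case False
      let ?K = "{K \<in> clusters Q q. q + 1 + Max K \<le> m}"
      let ?len = "\<lambda>K. q + 1 + Max K"
      have inj': "inj_on ?len ?K"
        using inj by (auto simp: inj_on_def)
      have "?len ` ?K \<subseteq> {..m}"
        by auto
      then have "finite (?len ` ?K)"
        by (rule finite_subset) simp
      moreover have "?P \<inter> {1..m} = insert 1 (?len ` ?K)"
        using False by auto
      moreover have "1 \<notin> ?len ` ?K"
        using q by auto
      moreover have "card (compositions ?P m) =
          (\<Sum>x\<in>?P \<inter> {1..m}. card (compositions ?P (m - x)))"
        using False by (intro card_compositions_pos) simp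
      ultimately have "card (compositions ?P m) = card (compositions ?P (m - 1)) +
          (\<Sum>x\<in>?len ` ?K. card (compositions ?P (m - x)))"
        by (simp only: sum.insert not_False_eq_True)
      also have "(\<Sum>x\<in>?len ` ?K. card (compositions ?P (m - x))) =
          (\<Sum>K\<in>?K. card (compositions ?P (m - ?len K)))"
        by (simp only: sum.reindex[OF inj'] o_def)
      also have "\<dots> = (\<Sum>K\<in>?K. card (difference_avoiding_subsets Q (m - ?len K - q)))"
        by (rule sum.cong) (use less in auto)
      also have "card (compositions ?P (m - 1)) = card (difference_avoiding_subsets Q (m - 1 - q))"
        using less False by simp
      finally have rec: "card (compositions ?P m) = card (difference_avoiding_subsets Q (m - 1 - q)) +
          (\<Sum>K\<in>?K. card (difference_avoiding_subsets Q (m - ?len K - q)))" .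
      show ?thesis
      proof (cases "m \<le> q")
        case True
        then have "?K = {}" by auto
        then show ?thesis using True rec by simp
      next
        case m: False
        have "?K = {K \<in> clusters Q q. Max K < m - q}"
          using m by auto
        moreover have "m - ?len K - q = m - q - 1 - Max K - q" for K
          by simp
        ultimately show ?thesis
          using rec m by (simp add: card_difference_avoiding_subsets_rec[OF Q, of "m - q"]
              diff_commute add.commute)
      qed
    qed
  qed
  from this[of "n + q"] show ?thesis by simp
qed

section \<open>Clusters of isolated gaps and one repeatable gap\<close>

lemma Max_insert_0: "Max {0, l} = (l :: nat)"
  by (cases "l = 0") auto

lemma Max_multiples: "Max ((\<lambda>i. i * t) ` {..j}) = j * (t :: nat)"
  by (rule Max_eqI) auto

text \<open>The gaps inside a cluster lie in \<open>insert t L\<close>. A gap \<open>l \<in> L\<close> with a neighbouring gap \<open>g\<close>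
  would produce the forbidden difference \<open>l + g\<close>, so it stands alone. A run of gaps \<open>t\<close> never
  meets a forbidden difference, as two of them already exceed \<open>q\<close>.\<close>

lemma clusters_eq:
  assumes gaps: "{1..q} - Q = insert t L" and Q: "Q \<subseteq> {..q}"
    and isolated: "\<And>l g. l \<in> L \<Longrightarrow> g \<in> insert t L \<Longrightarrow> l + g \<in> Q"
    and short: "\<And>l. l \<in> L \<Longrightarrow> l < t" and repeatable: "q < 2 * t"
  shows "clusters Q q = (\<lambda>l. {0, l}) ` L \<union> range (\<lambda>j. (\<lambda>i. i * t) ` {..j})"
proof (intro equalityI subsetI)
  have t: "t \<in> {1..q}" "t \<notin> Q" and L: "\<And>l. l \<in> L \<Longrightarrow> l \<in> {1..q} \<and> l \<notin> Q"
    using gaps by blast+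
  fix K assume "K \<in> clusters Q q"
  then have K: "finite K" "0 \<in> K" "avoiding Q K"
    and next_elem: "\<And>x. x \<in> K \<Longrightarrow> x < Max K \<Longrightarrow> \<exists>y\<in>K. x < y \<and> y \<le> x + q"
    by (auto simp: clusters_def)
  have gap: "y - x \<in> insert t L" if "x \<in> K" "y \<in> K" "x < y" "y \<le> x + q" for x y
    using avoidingD[OF K(3) that(1-3)] that(3,4) unfolding gaps[symmetric] by auto
  show "K \<in> (\<lambda>l. {0, l}) ` L \<union> range (\<lambda>j. (\<lambda>i. i * t) ` {..j})"
  proof (cases "\<exists>l\<in>L. l \<in> K")
    case True
    then obtain l where l: "l \<in> L" "l \<in> K" by blast
    have "\<not> l < Max K"
    proof
      assume "l < Max K"
      then obtain y where y: "y \<in> K" "l < y" "y \<le> l + q"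
        using next_elem l by blast
      from isolated[OF l(1) gap[OF l(2) y]] have "y \<in> Q" using y by simp
      with avoidingD[OF K(3,2) y(1)] y show False by simp
    qed
    moreover have "x \<notin> K" if x: "0 < x" "x < l" for x
    proof
      assume xK: "x \<in> K"
      have "l \<le> q" using L l by auto
      then have "x \<in> insert t L" "l - x \<in> insert t L"
        using gap[OF K(2) xK] gap[OF xK l(2)] x by auto
      then have "x + (l - x) \<in> Q"
        using isolated[of x "l - x"] short[OF l(1)] x by auto
      with L[OF l(1)] x show False by simp
    qed
    ultimately have "K = {0, l}"
      using l(2) K(1,2) by (auto simp: not_less) (metis Max_ge le_antisym le_less_linear)
    with l show ?thesis by blast
  next
    case False
    \<comment> \<open>\<open>j\<close> is the number of gaps \<open>t\<close> that \<open>K\<close> has in succession from \<open>0\<close> on.\<close>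
    define j where "j = (LEAST j. Suc j * t \<notin> K)"
    have "Suc (Max K) * t \<notin> K"
    proof
      assume "Suc (Max K) * t \<in> K"
      then have "Suc (Max K) * t \<le> Max K" using K(1) by simp
      moreover have "Suc (Max K) * 1 \<le> Suc (Max K) * t" using t(1) by (intro mult_le_mono2) auto
      ultimately show False by simp
    qed
    then have j: "Suc j * t \<notin> K"
      unfolding j_def by (rule LeastI)
    have "Suc i * t \<in> K" if "i < j" for i
      using not_less_Least that unfolding j_def by blast
    then have mult: "i * t \<in> K" if "i \<le> j" for i
      using that K(2) by (cases i) (auto simp only: Suc_le_eq mult_0)
    have run: "x \<in> (\<lambda>i. i * t) ` {..j}" if x: "x \<in> K" "x \<le> j * t + q" for x
    proof (rule ccontr)
      assume no: "x \<notin> (\<lambda>i. i * t) ` {..j}"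
      \<comment> \<open>\<open>i * t\<close> is the last multiple of \<open>t\<close> in the run that lies below \<open>x\<close>.\<close>
      define i where "i = min j (x div t)"
      have "i * t \<le> x"
        unfolding i_def by (metis div_times_less_eq_dividend le_trans min.cobounded2 mult_le_mono1)
      moreover have ij: "i \<le> j" by (simp add: i_def)
      ultimately have ix: "i * t < x" using no by (auto simp: le_less)
      have "x \<le> i * t + q"
      proof (cases "i = j")
        case False
        then have "i = x div t" by (auto simp: i_def min_def split: if_splits)
        then have "x < i * t + t"
          using t(1) by (simp add: dividend_less_div_times add.commute)
        with t(1) show ?thesis by auto
      qed (use x in simp)
      then have g: "x - i * t \<in> insert t L"
        using gap[OF mult[OF ij] x(1) ix] by simp
      show False
      proof (cases "x - i * t = t")
        case True
        then have x': "x = Suc i * t" using ix by simp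
        show False
        proof (cases "i = j")
          case True
          with x' x(1) j show False by simp
        next
          case False
          with ij x' no show False by (metis Suc_leI atMost_iff image_eqI le_neq_implies_less)
        qed
      next
        case l: False
        then have l: "x - i * t \<in> L" using g by simp
        show False
        proof (cases i)
          case 0
          with l x(1) False show False by simp
        next
          case (Suc i')
          \<comment> \<open>The gap in \<open>L\<close> would follow a gap \<open>t\<close>.\<close>
          then have "x - i' * t = x - i * t + t" "i' * t < x" using ix by auto
          moreover have "i' * t \<in> K" using mult ij Suc by simp
          ultimately show False
            using isolated[OF l, of t] avoidingD[OF K(3) _ x(1), of "i' * t"] by simp
        qed
      qed
    qed
    have "Max K = j * t"
    proof (rule antisym[OF leI])
      show "\<not> j * t < Max K"
      proof
        assume "j * t < Max K"
        then obtain y where "y \<in> K" "j * t < y" "y \<le> j * t + q"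
          using next_elem mult[of j] by auto
        with run[of y] show False by (auto simp: not_less)
      qed
    qed (use mult[of j] K(1) in simp)
    then have "K \<subseteq> (\<lambda>i. i * t) ` {..j}"
      using run K(1) by (metis Max_ge subsetI trans_le_add1)
    with mult have "K = (\<lambda>i. i * t) ` {..j}" by auto
    then show ?thesis by blast
  qed
next
  have t: "t \<in> {1..q}" "t \<notin> Q" and L: "\<And>l. l \<in> L \<Longrightarrow> l \<in> {1..q} \<and> l \<notin> Q"
    using gaps by blast+
  fix K assume "K \<in> (\<lambda>l. {0, l}) ` L \<union> range (\<lambda>j. (\<lambda>i. i * t) ` {..j})"
  then consider l where "l \<in> L" "K = {0, l}" | j where "K = (\<lambda>i. i * t) ` {..j}"
    by blast
  then show "K \<in> clusters Q q"
  proof cases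
    case 1
    with L[of l] show ?thesis by (auto simp: clusters_def avoiding_def)
  next
    case 2
    have "avoiding Q K"
      unfolding avoiding_def
    proof (intro ballI impI)
      fix x y assume "x \<in> K" "y \<in> K" "x < y"
      then obtain i k where ik: "x = i * t" "y = k * t" "i < k" using 2 by auto
      then have yx: "y - x = (k - i) * t" by (simp add: diff_mult_distrib)
      show "y - x \<notin> Q"
      proof (cases "k - i = 1")
        case True
        then show ?thesis using t yx by simp
      next
        case False
        then have "2 * t \<le> y - x" unfolding yx using ik by (intro mult_le_mono1) simp
        with repeatable Q show ?thesis by auto
      qed
    qed
    moreover have "\<exists>y\<in>K. x < y \<and> y \<le> x + q" if "x \<in> K" "x < Max K" for x
    proof -
      have "Max K = j * t" using 2 by (simp only: Max_multiples)
      with that obtain i where i: "x = i * t" "i < j" using 2 by auto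
      then have "Suc i * t \<in> K" unfolding 2 by (intro imageI) simp
      then show ?thesis using i t(1) by (intro bexI[of _ "Suc i * t"]) auto
    qed
    ultimately show ?thesis using 2 by (auto simp: clusters_def)
  qed
qed

text \<open>Spans do not collide: an element of \<open>L\<close> lies strictly between \<open>0\<close> and \<open>t\<close>, so it is not a
  multiple of \<open>t\<close>.\<close>

lemma spans_of_clusters:
  assumes "{1..q} - Q = insert t L" and "Q \<subseteq> {..q}"
    and "\<And>l g. l \<in> L \<Longrightarrow> g \<in> insert t L \<Longrightarrow> l + g \<in> Q"
    and short: "\<And>l. l \<in> L \<Longrightarrow> l < t" and "q < 2 * t"
  shows "inj_on Max (clusters Q q)" and "Max ` clusters Q q = L \<union> range (\<lambda>j. j * t)"
proof -
  note eq = clusters_eq[OF assms]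
  show "Max ` clusters Q q = L \<union> range (\<lambda>j. j * t)"
    by (simp only: eq image_Un image_image Max_insert_0 Max_multiples image_ident)
  have "l \<noteq> j * t" if "l \<in> L" for l j
  proof -
    have "l \<in> {1..q}" using assms(1) that by blast
    with short[OF that] show ?thesis by (cases j) auto
  qed
  moreover have "t \<in> {1..q}" using assms(1) by blast
  then have "0 < t" by simp
  ultimately show "inj_on Max (clusters Q q)"
    by (simp only: eq inj_on_Un) (force simp: inj_on_def Max_insert_0 Max_multiples)
qed

section \<open>Bit strings\<close>

lemma bit_sum_powers:
  "finite A \<Longrightarrow> bit (\<Sum>i\<in>A. 2 ^ i :: nat) k \<longleftrightarrow> k \<in> A"
proof (induction A arbitrary: k rule: finite_induct)
  case (insert x A)
  have "2 ^ x AND (\<Sum>i\<in>A. 2 ^ i :: nat) = 0"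
    using insert by (intro bit_eqI) (auto simp: bit_and_iff bit_exp_iff)
  then show ?case
    using insert by (simp add: disjunctive_add_eq_or bit_or_iff bit_exp_iff)
qed simp

lemma bit_bit_string:
  assumes "finite Q" and "\<forall>j\<in>Q. 0 < j"
  shows "bit (bit_string Q) k \<longleftrightarrow> Suc k \<in> Q"
proof -
  have "inj_on (\<lambda>j. j - 1) Q"
    using assms(2) by (intro inj_onI) (metis Suc_pred')
  then have "bit_string Q = (\<Sum>i\<in>(\<lambda>j. j - 1) ` Q. 2 ^ i)"
    by (simp add: bit_string_def sum.reindex)
  moreover have "k \<in> (\<lambda>j. j - 1) ` Q \<longleftrightarrow> Suc k \<in> Q"
    using assms(2) by (force simp: image_iff)
  ultimately show ?thesis
    using assms(1) by (simp add: bit_sum_powers)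
qed

text \<open>The leading bit of the bit string is the one of \<open>q\<close>, so all the bits below it must be set:
  every \<open>g \<le> q\<close> outside \<open>Q\<close> is moved into \<open>Q\<close> by adding \<open>s\<close>.\<close>

lemma all_ones_shiftD:
  assumes "finite Q" and "\<forall>j\<in>Q. 0 < j" and "q \<in> Q"
    and ones: "all_ones (bit_string Q OR (bit_string Q div 2 ^ s))"
    and g: "g \<in> {1..q} - Q"
  shows "s + g \<in> Q"
proof -
  let ?b = "bit_string Q OR (bit_string Q div 2 ^ s)"
  have bit: "bit ?b k \<longleftrightarrow> Suc k \<in> Q \<or> Suc (s + k) \<in> Q" for k
    using assms(1,2)
    by (simp add: bit_or_iff bit_bit_string flip: drop_bit_eq_div)
      (simp add: bit_drop_bit_eq bit_bit_string)
  have "bit ?b (q - 1)"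
    using bit[of "q - 1"] assms(2,3) by simp
  moreover have "g - 1 \<le> q - 1" using g by auto
  ultimately have "bit ?b (g - 1)"
    using ones by (auto simp: all_ones_def)
  with bit[of "g - 1"] g show ?thesis by auto
qed

section \<open>The number of avoiding subsets\<close>

theorem theorem20:
  fixes Q :: "nat set" and q a r \<theta> n :: nat and p :: "nat \<Rightarrow> nat"
  assumes "finite Q" and "Q \<noteq> {}" and "\<forall>j\<in>Q. 0 < j"
    and "q = Max Q"
    and "strict_mono_on {1..a} p" and "p ` {1..a} = {1..q} - Q"
    and "a \<ge> 2"
    and "p a + r = q"
    and "\<theta> = bit_string Q"
    and "\<forall>i\<in>{1..a - 1}. all_ones (\<theta> OR (\<theta> div 2 ^ p i))"
    and "q = 2 * r + 1 \<or> (q > 2 * r + 1 \<and> 1 \<le> p (a - 1) \<and> p (a - 1) \<le> r)"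
  shows "card (difference_avoiding_subsets Q n) =
         card (compositions
           ({1, q + 1} \<union> {q + 1 + p i |i. i \<in> {1..a - 1}}
             \<union> {q + 1 + j * (q - r) |j. j \<ge> 1})
           (n + q))"
proof -
  define L where "L = p ` {1..a - 1}"
  have t: "p a = q - r" using assms(8) by simp
  have qQ: "q \<in> Q" and QU: "Q \<subseteq> {..q}"
    using assms(1,2,4) by auto
  have "{1..a} = insert a {1..a - 1}"
    using assms(7) by auto
  then have gaps: "{1..q} - Q = insert (q - r) L"
    using assms(6) t by (metis L_def image_insert)
  have isolated: "l + g \<in> Q" if l: "l \<in> L" and g: "g \<in> insert (q - r) L" for l g
  proof -
    obtain i where i: "i \<in> {1..a - 1}" "l = p i"
      using l unfolding L_def by blast
    then have "all_ones (bit_string Q OR (bit_string Q div 2 ^ l))"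
      using assms(9,10) by blast
    then show ?thesis
      by (rule all_ones_shiftD[OF assms(1,3) qQ]) (simp only: gaps g)
  qed
  have short: "l < q - r" if l: "l \<in> L" for l
  proof -
    obtain i where i: "i \<in> {1..a - 1}" "l = p i"
      using l unfolding L_def by blast
    then have "p i < p a"
      using assms(7) by (intro strict_mono_onD[OF assms(5)]) auto
    with i t show ?thesis by simp
  qed
  have repeatable: "q < 2 * (q - r)"
    using assms(11) by auto
  note spans = spans_of_clusters[OF gaps QU isolated short repeatable]
  have "range (\<lambda>j. j * (q - r)) = insert 0 {j * (q - r) |j. j \<ge> 1}"
  proof (intro equalityI subsetI)
    fix x assume "x \<in> range (\<lambda>j. j * (q - r))"
    then obtain j where "x = j * (q - r)" by blast
    then show "x \<in> insert 0 {j * (q - r) |j. j \<ge> 1}"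
      by (cases "j = 0") auto
  next
    fix x assume "x \<in> insert 0 {j * (q - r) |j. j \<ge> 1}"
    then have "x = 0 * (q - r) \<or> (\<exists>j. x = j * (q - r))" by auto
    then show "x \<in> range (\<lambda>j. j * (q - r))" by blast
  qed
  then have "Max ` clusters Q q = insert 0 (L \<union> {j * (q - r) |j. j \<ge> 1})"
    by (simp only: spans(2) Un_insert_right)
  then have "(\<lambda>K. q + 1 + Max K) ` clusters Q q =
      (\<lambda>d. q + 1 + d) ` insert 0 (L \<union> {j * (q - r) |j. j \<ge> 1})"
    by (metis image_image)
  also have "\<dots> = insert (q + 1) ({q + 1 + p i |i. i \<in> {1..a - 1}} \<union> {q + 1 + j * (q - r) |j. j \<ge> 1})"
    by (simp only: L_def image_insert image_Un image_image add_0_right setcompr_eq_image)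
      (simp only: Setcompr_eq_image mem_Collect_eq image_image Collect_mem_eq)
  finally have "{1} \<union> (\<lambda>K. q + 1 + Max K) ` clusters Q q =
      {1, q + 1} \<union> {q + 1 + p i |i. i \<in> {1..a - 1}} \<union> {q + 1 + j * (q - r) |j. j \<ge> 1}"
    by (simp only:) blast
  moreover have "0 < q" using assms(3) qQ by blast
  ultimately show ?thesis
    using card_avoiding_eq_card_compositions[OF QU _ spans(1), of n] by (simp only:)
qed

end
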